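(* Define the generating function $$W^{(\mathrm{op})}(X,Y):=\frac{1}{X\,(X+Y)\,(Y-X)}+\sum_{n\ge k>0}\eta_{n,k}\,X^{n-k-1}\,Y^{2k-2},$$ where for integers $n\ge k>0$ $$\eta_{n,k}=\sum_{r=-1}^{n-k-1}(-2)^{r+2}\binom{k+n-r-3}{2k-2}\,H(k+n-r-2,r+2).$$ Then $$W^{(\mathrm{op})}(X,Y)=\left(\frac{\sin\big(\pi(X+Y)\big)}{\sin\big(\pi(Y-X)\big)}-1\right)\frac{V^{(\mathrm{op})}(2X,-X-Y,Y-X)}{2\,X^2\,(X+Y)}.$$
   Context: $H(k,r)=\zeta(\underbrace{1,\ldots,1}_{r-1},k+1)$ for $k,r\ge1$, where $\zeta(k_1,\ldots,k_m)=\sum_{0<n_1<\cdots<n_m}n_1^{-k_1}\cdots n_m^{-k_m}$. For $s+t+u=0$, $$V^{(\mathrm{op})}(s,t,u)=\frac{\Gamma(1+s)\,\Gamma(1+t)}{\Gamma(1-u)}.$$ The identity is one of generating series at the origin: $X$ times the difference of the right-hand side and $\frac{1}{X(X+Y)(Y-X)}$ is holomorphic near $(X,Y)=(0,0)$ and its Taylor series is $\sum_{n\ge k>0}\eta_{n,k}X^{n-k}Y^{2k-2}$. *)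

theory Defs
  imports "HOL-Analysis.Analysis"
begin

(* Multiple zeta values with the convention 0 < n_1 < ... < n_m, so the last exponent must be
   at least 2 for convergence; a divergent series gets the default value 0 of infsum. *)
definition mzv :: "nat list \<Rightarrow> real" where
  "mzv ks = (\<Sum>\<^sub>\<infinity>ns\<in>{ns. length ns = length ks \<and> sorted_wrt (<) ns \<and> (\<forall>n\<in>set ns. 0 < n)}.
     \<Prod>i<length ks. 1 / real (ns ! i) ^ (ks ! i))"

(* Meant for k, r >= 1. *)
definition H :: "nat \<Rightarrow> nat \<Rightarrow> real" where
  "H k r = mzv (replicate (r - 1) 1 @ [k + 1])"

(* Meant for n >= k > 0; every argument of nat is then nonnegative, and H only
   receives positive arguments. *)
definition eta :: "nat \<Rightarrow> nat \<Rightarrow> real" where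
  "eta n k = (\<Sum>r = - 1..int n - int k - 1.
     (-2) ^ nat (r + 2)
     * real (nat (int k + int n - r - 3) choose (2 * k - 2))
     * H (nat (int k + int n - r - 2)) (nat (r + 2)))"

(* Only used for s + t + u = 0. *)
definition V_op :: "complex \<Rightarrow> complex \<Rightarrow> complex \<Rightarrow> complex" where
  "V_op s t u = Gamma (1 + s) * Gamma (1 + t) / Gamma (1 - u)"

(* The exponent n - k - 1 equals -1 for n = k. *)
definition W_op :: "complex \<Rightarrow> complex \<Rightarrow> complex" where
  "W_op X Y = 1 / (X * (X + Y) * (Y - X))
     + (\<Sum>\<^sub>\<infinity>(n, k)\<in>{(n, k). 0 < k \<and> k \<le> n}.
          of_real (eta n k) * X powi (int n - int k - 1) * Y ^ (2 * k - 2))"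

end

(* With j = r + 2 and m = k + n - j, summing over k first turns the series into
   -(G(X + Y, -2X) + G(X - Y, -2X)), where G(x, y) is the sum of H(m, j) x^(m-1) y^(j-1).
   Summing first over m and over the inner summation indices of H shows that 1 - x y G(x, y) is
   the hypergeometric series 2F1(y, -x; 1 - x; 1), which Gauss' theorem evaluates to
   Gamma(1-x) Gamma(1-y) / Gamma(1-x-y); the reflection formula then relates the two values
   of G to each other. *)
theory Submission
  imports Defs
begin

section \<open>Gauss' hypergeometric theorem\<close>

text \<open>Gauss' theorem is established in the region \<open>Re c > norm a + norm b\<close>, where
  the terms are dominated by a convergent series with nonnegative real parameters. There a
  telescoping identity relates the sum at c to the sum at c + 1; iterating it to c + N, where the
  sum tends to 1, leaves a quotient of Pochhammer symbols whose limit is the Gamma quotient. For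
  2F1(y, -x; 1 - x; 1) the condition follows from 2 |x| + |y| < 1. The final radius 1/8 makes X + Y,
  X - Y and 2 X smaller than 1/4 in norm, so that 2 |x| + |y| < 3/4. The obstacle is that every
  change of summation order needs absolute convergence. The series for G has nonnegative
  coefficients, so its sum of norms is the same series at |x| and |y|, and the evaluation supplies
  its own majorant. Even the convergence of the series that defines \<open>H\<close> is obtained
  this way, from a subfamily. The closed form divides by x y; where that is 0, convergence comes
  from comparison with x = y = 1/4.\<close>

definition hyp_term :: "'a::real_normed_field \<Rightarrow> 'a \<Rightarrow> 'a \<Rightarrow> nat \<Rightarrow> 'a" where
  "hyp_term a b c n = pochhammer a n * pochhammer b n / (pochhammer c n * fact n)"

lemma hyp_term_0 [simp]: "hyp_term a b c 0 = 1"
  by (simp add: hyp_term_def)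

lemma hyp_term_Suc:
  "hyp_term a b c (Suc n) =
     hyp_term a b c n * ((a + of_nat n) * (b + of_nat n) / ((c + of_nat n) * of_nat (Suc n)))"
  by (simp add: hyp_term_def pochhammer_Suc mult_ac del: of_nat_Suc)

lemma hyp_term_nonneg:
  fixes a b c :: real
  assumes "a \<ge> 0" "b \<ge> 0" "c > 0"
  shows "hyp_term a b c n \<ge> 0"
  using assms by (induction n) (auto simp: hyp_term_Suc intro!: mult_nonneg_nonneg divide_nonneg_nonneg)

text \<open>The n^2 cancels in (a + n) (b + n) - n (c + n), so for large n the factor has the sign
  of -(c - a - b). This identity drives convergence, the decay of n times the term, and the
  contiguous relation.\<close>

lemma hyp_term_telescope:
  assumes "c + of_nat n \<noteq> 0"
  shows "of_nat (Suc n) * hyp_term a b c (Suc n) - of_nat n * hyp_term a b c n =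
           hyp_term a b c n * (a * b - of_nat n * (c - a - b)) / (c + of_nat n)"
proof -
  have "of_nat (Suc n) * hyp_term a b c (Suc n) =
          hyp_term a b c n * ((a + of_nat n) * (b + of_nat n) / (c + of_nat n))"
    unfolding hyp_term_Suc by (simp del: of_nat_Suc)
  thus ?thesis using assms by (simp add: field_simps)
qed

section \<open>Convergence for real parameters\<close>

text \<open>Raabe's test made explicit: for large n, n t(n) decreases by at least a fixed multiple
  of t(n), so a telescoping series dominates t. The limit of n t(n) is 0, since a positive limit
  would make the harmonic series converge.\<close>

lemma hyp_term_summable_real:
  fixes a b c :: real
  assumes "a \<ge> 0" "b \<ge> 0" "c > a + b"
  shows "summable (hyp_term a b c)"
    and "(\<lambda>n. real n * hyp_term a b c n) \<longlonglongrightarrow> 0"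
proof -
  define t where "t = hyp_term a b c"
  define s where "s n = real n * t n" for n
  define d where "d = c - a - b"
  have d: "d > 0" and c: "c > 0" using assms by (auto simp: d_def)
  have t: "t n \<ge> 0" for n
    unfolding t_def using assms by (intro hyp_term_nonneg) auto
  \<comment> \<open>Chosen so that n d - a b >= (d / 2) (c + n) for n >= N, which amounts to n d >=
    c d + 2 a b.\<close>
  obtain N where N: "real N \<ge> c + 2 * a * b / d"
    using real_arch_simple by blast
  have step: "t n * (d / 2) \<le> s n - s (Suc n)" if "n \<ge> N" for n
  proof -
    have "c + 2 * a * b / d \<le> real n" using N that by linarith
    hence "(c + 2 * a * b / d) * d \<le> real n * d"
      using d by (intro mult_right_mono) auto
    hence "c * d + 2 * a * b \<le> real n * d" using d by (simp add: algebra_simps)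
    hence "(d / 2) * (c + real n) \<le> real n * d - a * b" by (simp add: field_simps)
    hence "d / 2 \<le> (real n * d - a * b) / (c + real n)"
      using c by (subst pos_le_divide_eq) auto
    hence "t n * (d / 2) \<le> t n * ((real n * d - a * b) / (c + real n))"
      using t by (rule mult_left_mono)
    also have "\<dots> = s n - s (Suc n)"
      using hyp_term_telescope[of c n a b] c
      by (simp add: s_def t_def d_def field_simps)
    finally show ?thesis .
  qed
  have "decseq (\<lambda>n. s (n + N))"
  proof (rule decseq_SucI)
    fix n
    have "0 \<le> t (n + N) * (d / 2)" using t d by simp
    thus "s (Suc n + N) \<le> s (n + N)" using step[of "n + N"] by simp
  qed
  moreover have "s n \<ge> 0" for n using t by (simp add: s_def)
  ultimately obtain L where "(\<lambda>n. s (n + N)) \<longlonglongrightarrow> L"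
    using decseq_convergent[of "\<lambda>n. s (n + N)" 0] by blast
  hence L: "s \<longlonglongrightarrow> L" by (rule LIMSEQ_offset)
  have "summable (\<lambda>n. s n - s (Suc n))"
    using telescope_summable'[OF L] by simp
  hence "summable (\<lambda>n. t n * (d / 2))"
    by (rule summable_comparison_test'[where N = N]) (use step t d in auto)
  hence sum: "summable t" using summable_mult[of _ "2 / d"] d by fastforce
  thus "summable (hyp_term a b c)" by (simp add: t_def)
  have "L \<ge> 0" by (rule LIMSEQ_le_const[OF L]) (use \<open>\<And>n. s n \<ge> 0\<close> in auto)
  moreover have "\<not> L > 0"
  proof
    assume "L > 0"
    hence "eventually (\<lambda>n. s n > L / 2) sequentially"
      using L by (intro order_tendstoD(1)) auto
    then obtain M where M: "\<And>n. n \<ge> M \<Longrightarrow> s n > L / 2"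
      by (auto simp: eventually_sequentially)
    have "summable (\<lambda>n. inverse (real n))"
    proof (rule summable_comparison_test'[where N = "Suc M"])
      show "summable (\<lambda>n. (2 / L) * t n)" using sum by (rule summable_mult)
      show "norm (inverse (real n)) \<le> (2 / L) * t n" if "n \<ge> Suc M" for n
        using M[of n] that \<open>L > 0\<close> by (simp add: s_def field_simps)
    qed
    thus False using not_summable_harmonic[where 'a=real] by (simp add: inverse_eq_divide)
  qed
  ultimately show "(\<lambda>n. real n * hyp_term a b c n) \<longlonglongrightarrow> 0"
    using L by (simp add: s_def[abs_def] t_def)
qed

section \<open>Majorants for complex parameters\<close>

lemma pochhammer_nonneg_weak:
  fixes a :: real
  assumes "a \<ge> 0"
  shows "pochhammer a n \<ge> 0"
  using assms by (induction n) (auto simp: pochhammer_Suc)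

lemma norm_pochhammer_le:
  fixes a :: "'a :: real_normed_field"
  shows "norm (pochhammer a n) \<le> pochhammer (norm a) n"
proof (induction n)
  case (Suc n)
  have "norm (a + of_nat n) \<le> norm a + real n"
    using norm_triangle_ineq[of a "of_nat n"] by simp
  thus ?case using Suc
    by (auto simp: pochhammer_Suc norm_mult intro!: mult_mono pochhammer_nonneg order.trans[OF norm_ge_zero Suc])
qed auto

lemma norm_pochhammer_ge:
  fixes c :: complex
  assumes "Re c > 0"
  shows "norm (pochhammer c n) \<ge> pochhammer (Re c) n"
proof (induction n)
  case (Suc n)
  have "Re c + real n \<le> norm (c + of_nat n)"
    using complex_Re_le_cmod[of "c + of_nat n"] by simp
  thus ?case using Suc assms
    by (auto simp: pochhammer_Suc norm_mult intro!: mult_mono)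
qed auto

text \<open>Factorwise |a + k| <= |a| + k and |c + k| >= Re c + k. The majorant converges for
  \<open>Re c > norm a + norm b\<close>, the condition imposed from here on.\<close>

lemma norm_hyp_term_le:
  fixes a b c :: complex
  assumes "Re c > 0"
  shows "norm (hyp_term a b c n) \<le> hyp_term (norm a) (norm b) (Re c) n"
proof -
  have "norm (pochhammer a n) * norm (pochhammer b n) \<le> pochhammer (norm a) n * pochhammer (norm b) n"
    using order.trans[OF norm_ge_zero norm_pochhammer_le]
    by (intro mult_mono norm_pochhammer_le) auto
  moreover have "0 < pochhammer (Re c) n * fact n"
    using assms by (simp add: pochhammer_pos)
  moreover have "pochhammer (Re c) n * fact n \<le> norm (pochhammer c n) * fact n"
    using assms norm_pochhammer_ge by (intro mult_right_mono) auto
  ultimately show ?thesis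
    unfolding hyp_term_def norm_mult norm_divide norm_fact
    by (intro frac_le) (auto intro: order.trans[OF _ \<open>norm _ * norm _ \<le> _\<close>])
qed

text \<open>Only the first factor of the Pochhammer symbol in the denominator supplies the gain c /
  (c + N); the others merely grow with N. At n = 0 there is no first factor.\<close>

lemma hyp_term_shift_le:
  fixes a b c :: real
  assumes "a \<ge> 0" "b \<ge> 0" "c > 0" "n > 0"
  shows "hyp_term a b (c + real N) n \<le> c / (c + real N) * hyp_term a b c n"
proof -
  obtain m where n: "n = Suc m" using \<open>n > 0\<close> gr0_implies_Suc by blast
  have *: "pochhammer (c + 1) m \<le> pochhammer (c + real N + 1) m"
    using assms unfolding pochhammer_prod by (intro prod_mono) auto
  have pos: "pochhammer (c + 1) m > 0" using assms by (intro pochhammer_pos) auto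
  have nn: "0 \<le> pochhammer a n * pochhammer b n / fact n"
    using assms pochhammer_nonneg_weak[of a n] pochhammer_nonneg_weak[of b n] by simp
  have "hyp_term a b (c + real N) n
      = (pochhammer a n * pochhammer b n / fact n) * (1 / (c + real N) * (1 / pochhammer (c + real N + 1) m))"
    by (simp add: hyp_term_def n pochhammer_rec)
  also have "\<dots> \<le> (pochhammer a n * pochhammer b n / fact n) * (1 / (c + real N) * (1 / pochhammer (c + 1) m))"
    using assms * pos nn by (intro mult_left_mono divide_left_mono) auto
  also have "\<dots> = c / (c + real N) * hyp_term a b c n"
    using assms by (simp add: hyp_term_def n pochhammer_rec mult_ac)
  finally show ?thesis .
qed

text \<open>Termwise form of Gauss' contiguous relation: over the common denominator c + n the
  numerator is minus the one in \<open>hyp_term_telescope\<close>, so this combination of the series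
  at c and c + 1 telescopes.\<close>

lemma hyp_term_contiguous:
  fixes c :: "'a :: real_normed_field"
  assumes "\<And>k. c + of_nat k \<noteq> 0"
  shows "c * (c - a - b) * hyp_term a b c n - (c - a) * (c - b) * hyp_term a b (c + 1) n =
           c * (of_nat n * hyp_term a b c n - of_nat (Suc n) * hyp_term a b c (Suc n))"
proof -
  have p: "pochhammer c (Suc n) = c * pochhammer (c + 1) n" by (rule pochhammer_rec)
  have "c * pochhammer (c + 1) n = pochhammer c n * (c + of_nat n)"
    using p by (simp add: pochhammer_Suc)
  moreover have nz: "c \<noteq> 0" "c + of_nat n \<noteq> 0" using assms[of 0] assms[of n] by auto
  ultimately have "pochhammer (c + 1) n = pochhammer c n * (c + of_nat n) / c"
    by (simp add: field_simps)
  hence "hyp_term a b (c + 1) n = hyp_term a b c n * c / (c + of_nat n)"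
    by (simp add: hyp_term_def)
  hence "c * (c - a - b) * hyp_term a b c n - (c - a) * (c - b) * hyp_term a b (c + 1) n
     = c * (hyp_term a b c n * ((c - a - b) * (c + of_nat n) - (c - a) * (c - b)) / (c + of_nat n))"
    using nz(2) by (simp add: field_simps)
  also have "(c - a - b) * (c + of_nat n) - (c - a) * (c - b) = - (a * b - of_nat n * (c - a - b))"
    by (simp add: algebra_simps)
  also have "c * (hyp_term a b c n * (- (a * b - of_nat n * (c - a - b))) / (c + of_nat n))
     = - (c * (of_nat (Suc n) * hyp_term a b c (Suc n) - of_nat n * hyp_term a b c n))"
    unfolding hyp_term_telescope[OF nz(2)] by (simp only: mult_minus_right minus_divide_left [symmetric] times_divide_eq_right)
  finally show ?thesis by (simp add: algebra_simps)
qed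

section \<open>Gauss' evaluation by shifting the lower parameter\<close>

context
  fixes a b :: complex
begin

lemma hyp_term_summable:
  assumes "Re c > norm a + norm b"
  shows "summable (\<lambda>n. norm (hyp_term a b c n))"
proof -
  have c: "Re c > 0" using assms norm_ge_zero[of a] norm_ge_zero[of b] by linarith
  show ?thesis
  proof (rule summable_comparison_test'[where N = 0])
    show "summable (hyp_term (norm a) (norm b) (Re c))"
      using assms by (intro hyp_term_summable_real) simp_all
    show "norm (norm (hyp_term a b c n)) \<le> hyp_term (norm a) (norm b) (Re c) n" for n
      using norm_hyp_term_le[OF c, of a b n] by simp
  qed
qed

lemma hyp_suminf_contiguous:
  assumes "Re c > norm a + norm b"
  shows "c * (c - a - b) * (\<Sum>n. hyp_term a b c n) =
           (c - a) * (c - b) * (\<Sum>n. hyp_term a b (c + 1) n)"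
proof -
  have c: "Re c > 0" using assms norm_ge_zero[of a] norm_ge_zero[of b] by linarith
  have nz: "c + of_nat k \<noteq> 0" for k using c by (auto simp: complex_eq_iff)
  have "(\<lambda>n. of_nat n * hyp_term a b c n) \<longlonglongrightarrow> 0"
  proof (rule Lim_null_comparison)
    show "(\<lambda>n. real n * hyp_term (norm a) (norm b) (Re c) n) \<longlonglongrightarrow> 0"
      using assms by (intro hyp_term_summable_real) auto
    show "\<forall>\<^sub>F n in sequentially. norm (of_nat n * hyp_term a b c n)
            \<le> real n * hyp_term (norm a) (norm b) (Re c) n"
      using norm_hyp_term_le[OF c] by (auto simp: norm_mult intro!: mult_left_mono always_eventually)
  qed
  from telescope_sums'[OF this]
  have "(\<lambda>n. c * (of_nat n * hyp_term a b c n - of_nat (Suc n) * hyp_term a b c (Suc n))) sums (c * 0)"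
    by (intro sums_mult) simp
  moreover have "(\<lambda>n. c * (c - a - b) * hyp_term a b c n - (c - a) * (c - b) * hyp_term a b (c + 1) n)
     sums (c * (c - a - b) * (\<Sum>n. hyp_term a b c n) - (c - a) * (c - b) * (\<Sum>n. hyp_term a b (c + 1) n))"
    using assms
    by (intro sums_diff sums_mult summable_sums summable_norm_cancel[OF hyp_term_summable]) auto
  ultimately have "c * (c - a - b) * (\<Sum>n. hyp_term a b c n) -
      (c - a) * (c - b) * (\<Sum>n. hyp_term a b (c + 1) n) = c * 0"
    unfolding hyp_term_contiguous[OF nz] by (rule sums_unique2[rotated])
  thus ?thesis by simp
qed

lemma hyp_suminf_shift:
  assumes "Re c > norm a + norm b"
  shows "pochhammer c N * pochhammer (c - a - b) N * (\<Sum>n. hyp_term a b c n) =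
           pochhammer (c - a) N * pochhammer (c - b) N * (\<Sum>n. hyp_term a b (c + of_nat N) n)"
proof (induction N)
  case (Suc N)
  define S where "S = (\<Sum>n. hyp_term a b c n)"
  define c' where "c' = c + of_nat N"
  have eq: "c - z + of_nat N = c' - z" "c + of_nat (Suc N) = c' + 1" for z
    by (simp_all add: c'_def)
  have eq': "c - a - b + of_nat N = c' - a - b"
    by (simp add: c'_def)
  have "pochhammer c (Suc N) * pochhammer (c - a - b) (Suc N) * S =
          c' * (c' - a - b) * (pochhammer c N * pochhammer (c - a - b) N * S)"
    by (simp add: pochhammer_Suc eq' flip: c'_def)
  also have "\<dots> = pochhammer (c - a) N * pochhammer (c - b) N *
       (c' * (c' - a - b) * (\<Sum>n. hyp_term a b c' n))"
    unfolding Suc[folded S_def c'_def] by (simp only: mult_ac)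
  also have "\<dots> = pochhammer (c - a) N * pochhammer (c - b) N *
       ((c' - a) * (c' - b) * (\<Sum>n. hyp_term a b (c' + 1) n))"
    by (subst hyp_suminf_contiguous) (use assms in \<open>auto simp: c'_def\<close>)
  also have "\<dots> = pochhammer (c - a) (Suc N) * pochhammer (c - b) (Suc N) *
       (\<Sum>n. hyp_term a b (c' + 1) n)"
    by (simp only: pochhammer_Suc eq mult_ac)
  finally show ?case unfolding S_def eq .
qed auto

text \<open>The term at n = 0 is 1 for every N; the rest is at most Re c / (Re c + N) times a
  convergent sum independent of N.\<close>

lemma hyp_suminf_shift_limit:
  assumes "Re c > norm a + norm b"
  shows "(\<lambda>N. \<Sum>n. hyp_term a b (c + of_nat N) n) \<longlonglongrightarrow> 1"
proof -
  have c: "Re c > 0" using assms norm_ge_zero[of a] norm_ge_zero[of b] by linarith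
  define M where "M = (\<Sum>n. hyp_term (norm a) (norm b) (Re c) (Suc n))"
  have sum: "summable (\<lambda>n. hyp_term (norm a) (norm b) (Re c) (Suc n))"
    using assms by (subst summable_Suc_iff) (intro hyp_term_summable_real, simp_all)
  have bound: "norm ((\<Sum>n. hyp_term a b (c + of_nat N) n) - 1) \<le> Re c / (Re c + real N) * M" for N
  proof -
    have "summable (hyp_term a b (c + of_nat N))"
      using assms by (intro summable_norm_cancel[OF hyp_term_summable]) auto
    hence "(\<Sum>n. hyp_term a b (c + of_nat N) n) - 1 = (\<Sum>n. hyp_term a b (c + of_nat N) (Suc n))"
      by (subst suminf_split_head) auto
    also have "norm \<dots> \<le> (\<Sum>n. Re c / (Re c + real N) * hyp_term (norm a) (norm b) (Re c) (Suc n))"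
    proof (rule norm_suminf_le)
      fix n
      have "norm (hyp_term a b (c + of_nat N) (Suc n)) \<le> hyp_term (norm a) (norm b) (Re c + real N) (Suc n)"
        using norm_hyp_term_le[of "c + of_nat N" a b "Suc n"] c by simp
      also have "\<dots> \<le> Re c / (Re c + real N) * hyp_term (norm a) (norm b) (Re c) (Suc n)"
        using c by (intro hyp_term_shift_le) auto
      finally show "norm (hyp_term a b (c + of_nat N) (Suc n)) \<le> \<dots>" .
    qed (use sum in \<open>rule summable_mult\<close>)
    also have "\<dots> = Re c / (Re c + real N) * M"
      unfolding M_def using sum by (rule suminf_mult)
    finally show ?thesis .
  qed
  have "(\<lambda>N. (\<Sum>n. hyp_term a b (c + of_nat N) n) - 1) \<longlonglongrightarrow> 0"
  proof (rule Lim_null_comparison)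
    show "(\<lambda>N. Re c / (Re c + real N) * M) \<longlonglongrightarrow> 0"
    proof -
      have "(\<lambda>N. Re c / (Re c + real N)) \<longlonglongrightarrow> 0"
        by (intro tendsto_divide_0[OF tendsto_const] filterlim_at_top_imp_at_infinity
              filterlim_tendsto_add_at_top[OF tendsto_const] filterlim_real_sequentially)
      thus ?thesis by (rule tendsto_mult_left_zero)
    qed
  qed (use bound in auto)
  thus ?thesis by (simp add: LIM_zero_iff)
qed

theorem Gauss_hypergeometric:
  assumes "Re c > norm a + norm b"
  shows "hyp_term a b c sums (Gamma c * Gamma (c - a - b) / (Gamma (c - a) * Gamma (c - b)))"
proof -
  define S where "S = (\<Sum>n. hyp_term a b c n)"
  have nz: "Gamma z \<noteq> 0" "\<And>n. pochhammer z n \<noteq> 0" if "Re z > 0" for z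
    using that by (auto simp: Gamma_eq_zero_iff pochhammer_eq_0_iff elim!: nonpos_Ints_cases)
  have pos: "Re c > 0" "Re (c - a) > 0" "Re (c - b) > 0" "Re (c - a - b) > 0"
    using assms complex_Re_le_cmod[of a] complex_Re_le_cmod[of b] norm_ge_zero[of a] norm_ge_zero[of b]
    by (simp_all del: norm_ge_zero)
  have "(\<lambda>N. Gamma_series' c N * Gamma_series' (c - a - b) N /
          (Gamma_series' (c - a) N * Gamma_series' (c - b) N) * (\<Sum>n. hyp_term a b (c + of_nat N) n))
        \<longlonglongrightarrow> Gamma c * Gamma (c - a - b) / (Gamma (c - a) * Gamma (c - b)) * 1"
    using nz pos by (intro tendsto_mult tendsto_divide Gamma_series'_LIMSEQ hyp_suminf_shift_limit assms) auto
  \<comment> \<open>The sequence is constant: the factorials cancel, the exponentials cancel because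
    c + (c - a - b) = (c - a) + (c - b), and the remaining Pochhammer quotient turns the shifted sum
    back into \<open>S\<close> by \<open>hyp_suminf_shift\<close>.\<close>
  moreover have "Gamma_series' c N * Gamma_series' (c - a - b) N /
          (Gamma_series' (c - a) N * Gamma_series' (c - b) N) * (\<Sum>n. hyp_term a b (c + of_nat N) n) = S"
    for N
  proof -
    define L where "L = complex_of_real (ln (real N))"
    have e: "exp (c * L) * exp ((c - a - b) * L) = exp ((c - a) * L) * exp ((c - b) * L)"
      by (simp add: exp_add[symmetric] algebra_simps)
    define P where "P = pochhammer c N * pochhammer (c - a - b) N"
    define Q where "Q = pochhammer (c - a) N * pochhammer (c - b) N"
    define F where "F = (\<Sum>n. hyp_term a b (c + of_nat N) n)"
    have PQ: "P \<noteq> 0" "Q \<noteq> 0"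
      unfolding P_def Q_def using pos[THEN nz(2), of N] by simp_all
    define A where "A = Gamma_series' c N * Gamma_series' (c - a - b) N"
    define B where "B = Gamma_series' (c - a) N * Gamma_series' (c - b) N"
    have A: "A = fact (N - 1) ^ 2 * (exp (c * L) * exp ((c - a - b) * L)) / P"
      by (simp add: A_def P_def Gamma_series'_def L_def power2_eq_square)
    have B: "B = fact (N - 1) ^ 2 * (exp (c * L) * exp ((c - a - b) * L)) / Q"
      unfolding e by (simp add: B_def Q_def Gamma_series'_def L_def power2_eq_square)
    have "P * S = Q * F"
      using hyp_suminf_shift[OF assms, of N] by (simp add: P_def Q_def F_def S_def)
    hence "Q / P * F = S" using PQ by (simp add: field_simps)
    moreover have "A / B = Q / P" unfolding A B using PQ by simp
    ultimately show ?thesis unfolding A_def B_def F_def by simp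
  qed
  ultimately have "S = Gamma c * Gamma (c - a - b) / (Gamma (c - a) * Gamma (c - b))"
    by (simp add: LIMSEQ_const_iff)
  thus ?thesis
    using summable_norm_cancel[OF hyp_term_summable[OF assms]] by (simp add: S_def sums_iff)
qed

end

section \<open>The generating function of height-one zeta values\<close>

text \<open>Fubini with explicit values: the iterated sum of norms gives absolute summability, after
  which the iterated sum of \<open>f\<close> is its total.\<close>

lemma has_sum_Sigma_norm:
  fixes f :: "'a \<times> 'b \<Rightarrow> 'c :: banach"
  assumes "\<And>x. x \<in> A \<Longrightarrow> ((\<lambda>y. f (x, y)) has_sum g x) (B x)" "(g has_sum S) A"
  assumes "\<And>x. x \<in> A \<Longrightarrow> ((\<lambda>y. norm (f (x, y))) has_sum h x) (B x)" "h summable_on A"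
  shows "(f has_sum S) (Sigma A B)"
proof -
  have "(\<lambda>z. norm (f z)) summable_on Sigma A B"
    using assms(3,4) by (rule summable_on_SigmaI) auto
  hence "f summable_on Sigma A B" by (rule abs_summable_summable)
  with assms(1,2) show ?thesis by (rule has_sum_SigmaI)
qed

lemma has_sum_geometric:
  fixes z :: "'a :: {real_normed_field, banach}"
  assumes "norm z < 1"
  shows "((\<lambda>n. z ^ n) has_sum (1 / (1 - z))) UNIV"
  using assms by (intro norm_summable_imp_has_sum geometric_sums) (simp_all add: norm_power summable_geometric)

text \<open>One summand of the series G: m + 1 is the largest entry of the zeta index,
  \<open>A\<close> the set of the others, p + 2 the last exponent, and the power of y is spread as
  one factor over each entry of \<open>A\<close>. With sets in place of increasing lists, the sum
  over all lengths factors into a product of 1 + y / i.\<close>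

definition gen_term :: "'a :: real_normed_field \<Rightarrow> 'a \<Rightarrow> nat \<times> nat set \<times> nat \<Rightarrow> 'a" where
  "gen_term x y = (\<lambda>(m, A, p). x ^ p / of_nat (Suc m) ^ (p + 2) * (\<Prod>i\<in>A. y / of_nat i))"

lemma norm_gen_term: "norm (gen_term x y z) = gen_term (norm x) (norm y) z"
  by (cases z) (simp add: gen_term_def norm_mult norm_divide norm_power prod_norm[symmetric] del: of_nat_Suc)

definition gen_sum :: "'a :: real_normed_field \<Rightarrow> 'a \<Rightarrow> nat \<Rightarrow> 'a" where
  "gen_sum x y m = pochhammer (1 + y) m / (fact (Suc m) * (of_nat (Suc m) - x))"

lemma prod_one_plus_divide:
  fixes y :: "'a :: field_char_0"
  shows "(\<Prod>i\<in>{1..m}. 1 + y / of_nat i) = pochhammer (1 + y) m / fact m"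
proof (induction m)
  case (Suc m)
  have "1 + y / of_nat (Suc m) = (1 + y + of_nat m) / of_nat (Suc m)"
  proof -
    have "1 + y + of_nat m = of_nat (Suc m) + y" by simp
    thus ?thesis by (simp only: add_divide_distrib) (simp del: of_nat_Suc)
  qed
  with Suc show ?case by (simp add: pochhammer_Suc mult_ac)
qed auto

lemma sum_Pow_prod:
  fixes y :: "'a :: field_char_0"
  shows "(\<Sum>A\<in>Pow {1..m}. \<Prod>i\<in>A. y / of_nat i) = pochhammer (1 + y) m / fact m"
proof -
  have "(\<Prod>i\<in>{1..m}. y / of_nat i + 1) = (\<Sum>A\<in>Pow {1..m}. (\<Prod>i\<in>A. y / of_nat i) * (\<Prod>i\<in>{1..m} - A. 1))"
    by (rule prod_add) simp
  thus ?thesis by (simp add: prod_one_plus_divide[symmetric] add.commute)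
qed

lemma gen_term_has_sum_inner:
  fixes x y :: "'a :: {real_normed_field, banach}"
  assumes "norm x < 1"
  shows "((\<lambda>z. gen_term x y (m, z)) has_sum gen_sum x y m) (Pow {1..m} \<times> UNIV)"
proof -
  \<comment> \<open>Stated for a fresh type because it is used twice: for the sum itself and, over
    the reals at the norms, for its majorant.\<close>
  have inner: "((\<lambda>p. gen_term x y (m, A, p)) has_sum
          1 / (of_nat (Suc m) * (of_nat (Suc m) - x)) * (\<Prod>i\<in>A. y / of_nat i)) UNIV"
    if "norm x < 1" for x y :: "'b :: {real_normed_field, banach}" and A
  proof -
    define c where "c = (of_nat (Suc m) :: 'b)"
    have c: "norm c \<ge> 1" unfolding c_def norm_of_nat by simp
    hence c0: "c \<noteq> 0" by auto
    have "norm x < norm c" using c that by linarith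
    hence "norm (x / c) < 1" "c - x \<noteq> 0" using c0 by (auto simp: norm_divide)
    have "((\<lambda>p. 1 / c ^ 2 * (x / c) ^ p * (\<Prod>i\<in>A. y / of_nat i)) has_sum
            1 / c ^ 2 * (1 / (1 - x / c)) * (\<Prod>i\<in>A. y / of_nat i)) UNIV"
      by (intro has_sum_cmult_left has_sum_cmult_right has_sum_geometric) fact
    also have "1 / c ^ 2 * (1 / (1 - x / c)) = 1 / (c * (c - x))"
      using c0 \<open>c - x \<noteq> 0\<close> by (simp add: field_simps power2_eq_square)
    also have "(\<lambda>p. 1 / c ^ 2 * (x / c) ^ p * (\<Prod>i\<in>A. y / of_nat i)) = (\<lambda>p. gen_term x y (m, A, p))"
      by (simp add: gen_term_def c_def power_divide power_add power2_eq_square mult_ac)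
    finally show ?thesis by (simp add: c_def)
  qed
  show ?thesis
  proof (rule has_sum_Sigma_norm[OF _ _ _ summable_on_finite])
    show "((\<lambda>p. gen_term x y (m, A, p)) has_sum
        1 / (of_nat (Suc m) * (of_nat (Suc m) - x)) * (\<Prod>i\<in>A. y / of_nat i)) UNIV" for A
      using assms by (rule inner)
    have "(\<Sum>A\<in>Pow {1..m}. 1 / (of_nat (Suc m) * (of_nat (Suc m) - x)) * (\<Prod>i\<in>A. y / of_nat i)) = gen_sum x y m"
      unfolding sum_distrib_left[symmetric] sum_Pow_prod by (simp add: gen_sum_def mult_ac)
    thus "((\<lambda>A. 1 / (of_nat (Suc m) * (of_nat (Suc m) - x)) * (\<Prod>i\<in>A. y / of_nat i)) has_sum gen_sum x y m)
            (Pow {1..m})"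
      by (intro has_sum_finiteI) auto
    show "((\<lambda>p. norm (gen_term x y (m, A, p))) has_sum
        1 / (of_nat (Suc m) * (of_nat (Suc m) - norm x)) * (\<Prod>i\<in>A. norm y / of_nat i)) UNIV" for A
      unfolding norm_gen_term using assms by (intro inner) simp
  qed auto
qed

context
  fixes x y :: complex
  assumes xy: "x \<noteq> 0" "y \<noteq> 0" "2 * norm x + norm y < 1"
begin

lemma Re_gt: "Re (1 - x) > norm y + norm (- x)"
  using xy complex_Re_le_cmod[of x] by simp

text \<open>The quotient of the Pochhammer symbols of -x and 1 - x collapses to -x / (m + 1 - x).
  The index is m + 1 because the term at 0 is the constant 1 in 1 - x y G.\<close>

lemma gen_sum_eq_hyp_term: "gen_sum x y m = - 1 / (x * y) * hyp_term y (- x) (1 - x) (Suc m)"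
proof -
  have "1 - x + of_nat k \<noteq> 0" for k
  proof -
    have "Re x < 1" using xy(3) complex_Re_le_cmod[of x] norm_ge_zero[of x] norm_ge_zero[of y] by linarith
    hence "Re (1 - x + of_nat k) > 0" by simp
    thus ?thesis by (metis less_irrefl zero_complex.simps(1))
  qed
  hence "pochhammer (1 - x) m \<noteq> 0" by (simp add: pochhammer_prod)
  have "pochhammer (-x) (Suc m) = - x * pochhammer (1 - x) m"
    by (simp add: pochhammer_rec add.commute)
  hence "hyp_term y (- x) (1 - x) (Suc m) =
        (y * pochhammer (1 + y) m) * (- x * pochhammer (1 - x) m) /
        (pochhammer (1 - x) m * (1 - x + of_nat m) * fact (Suc m))"
    unfolding hyp_term_def by (simp only: pochhammer_rec[of y] pochhammer_Suc[of "1 - x"] add.commute)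
  also have "\<dots> = (y * pochhammer (1 + y) m) * (- x) / ((1 - x + of_nat m) * fact (Suc m))"
    using \<open>pochhammer (1 - x) m \<noteq> 0\<close> by simp
  also have "1 - x + of_nat m = of_nat (Suc m) - x" by simp
  finally show ?thesis using xy unfolding gen_sum_def by (simp add: mult_ac del: of_nat_Suc fact_Suc)
qed

lemma gen_sum_norm_summable: "summable (\<lambda>m. norm (gen_sum x y m))"
  unfolding gen_sum_eq_hyp_term norm_mult
  by (intro summable_mult summable_Suc_iff[THEN iffD2] hyp_term_summable Re_gt)

lemma gen_sum_has_sum:
  "(gen_sum x y has_sum ((1 - Gamma (1 - x) * Gamma (1 - y) / Gamma (1 - x - y)) / (x * y))) UNIV"
proof (rule norm_summable_imp_has_sum[OF gen_sum_norm_summable])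
  have "hyp_term y (-x) (1 - x) sums (Gamma (1 - x) * Gamma (1 - y) / Gamma (1 - x - y))"
    using Gauss_hypergeometric[OF Re_gt] by simp
  hence "(\<lambda>m. hyp_term y (-x) (1 - x) (Suc m)) sums (Gamma (1 - x) * Gamma (1 - y) / Gamma (1 - x - y) - 1)"
    by (subst sums_Suc_iff) simp
  hence "gen_sum x y sums (- 1 / (x * y) * (Gamma (1 - x) * Gamma (1 - y) / Gamma (1 - x - y) - 1))"
    unfolding gen_sum_eq_hyp_term by (rule sums_mult)
  also have "- 1 / (x * y) * (G - 1) = (1 - G) / (x * y)" for G
    using xy by (simp add: field_simps)
  finally show "gen_sum x y sums ((1 - Gamma (1 - x) * Gamma (1 - y) / Gamma (1 - x - y)) / (x * y))" .
qed

end

text \<open>The hypotheses depend on norms only, so the complex result applies to the norms embedded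
  as complex numbers.\<close>

lemma gen_sum_real_summable:
  fixes x y :: complex
  assumes "x \<noteq> 0" "y \<noteq> 0" "2 * norm x + norm y < 1"
  shows "gen_sum (norm x) (norm y) summable_on UNIV"
proof -
  define x' y' where "x' = complex_of_real (norm x)" and "y' = complex_of_real (norm y)"
  have "norm (gen_sum x' y' m) = norm (gen_sum (norm x) (norm y) m)" for m
  proof -
    have "gen_sum x' y' m = of_real (gen_sum (norm x) (norm y) m)"
      by (simp add: gen_sum_def x'_def y'_def flip: pochhammer_of_real)
    thus ?thesis by (simp only: norm_of_real real_norm_def)
  qed
  moreover have "summable (\<lambda>m. norm (gen_sum x' y' m))"
    by (rule gen_sum_norm_summable) (use assms in \<open>auto simp: x'_def y'_def\<close>)
  ultimately show ?thesis
    by (intro norm_summable_imp_summable_on) simp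
qed

lemma gen_term_has_sum:
  fixes x y :: complex
  assumes xy: "x \<noteq> 0" "y \<noteq> 0" "2 * norm x + norm y < 1"
  shows "(gen_term x y has_sum ((1 - Gamma (1 - x) * Gamma (1 - y) / Gamma (1 - x - y)) / (x * y)))
           (SIGMA m:UNIV. Pow {1..m} \<times> UNIV)"
proof (rule has_sum_Sigma_norm)
  have x: "norm x < 1" using xy norm_ge_zero[of y] norm_ge_zero[of x] by linarith
  show "((\<lambda>z. gen_term x y (m, z)) has_sum gen_sum x y m) (Pow {1..m} \<times> UNIV)" for m
    using x by (rule gen_term_has_sum_inner)
  show "((\<lambda>z. norm (gen_term x y (m, z))) has_sum gen_sum (norm x) (norm y) m) (Pow {1..m} \<times> UNIV)" for m
    unfolding norm_gen_term using x by (intro gen_term_has_sum_inner) simp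
  show "(gen_sum x y has_sum ((1 - Gamma (1 - x) * Gamma (1 - y) / Gamma (1 - x - y)) / (x * y))) UNIV"
    using xy by (rule gen_sum_has_sum)
  show "gen_sum (norm x) (norm y) summable_on UNIV"
    using xy by (rule gen_sum_real_summable)
qed

text \<open>
  \<open>(m, A)\<close> encodes the summation index of a multiple zeta value whose largest entry is \<open>m + 1\<close>
  and whose other entries form the set \<open>A\<close>.
\<close>
definition chain_set :: "nat \<Rightarrow> (nat \<times> nat set) set" where
  "chain_set q = {(m, A). A \<subseteq> {1..m} \<and> card A = q}"

definition chain_term :: "nat \<Rightarrow> nat \<times> nat set \<Rightarrow> real" where
  "chain_term p = (\<lambda>(m, A). 1 / real (Suc m) ^ (p + 2) * (\<Prod>i\<in>A. 1 / real i))"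

text \<open>An increasing list is its last entry together with the set of the earlier ones.
  Reindexing \<open>infsum\<close> along a bijection preserves even the default value of a divergent
  series; convergence is settled in \<open>chain_term_has_sum\<close>.\<close>

lemma H_eq_infsum_chains: "H (Suc p) (Suc q) = infsum (chain_term p) (chain_set q)"
proof -
  define ks where "ks = replicate q 1 @ [p + 2]"
  define L :: "nat list set" where "L = {ns. length ns = length ks \<and> sorted_wrt (<) ns \<and> (\<forall>n\<in>set ns. 0 < n)}"
  define f where "f = (\<lambda>(m, A). sorted_list_of_set A @ [Suc m])"
  have bij: "bij_betw f (chain_set q) L"
  proof (rule bij_betw_byWitness[where f' = "\<lambda>ns. (last ns - 1, set (butlast ns))"])
    show "\<forall>z\<in>chain_set q. (last (f z) - 1, set (butlast (f z))) = z"
    proof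
      fix z assume "z \<in> chain_set q"
      moreover obtain m A where z: "z = (m, A)" by fastforce
      ultimately have "finite A" by (auto simp: chain_set_def intro: finite_subset)
      thus "(last (f z) - 1, set (butlast (f z))) = z" by (simp add: z f_def)
    qed
    show "\<forall>ns\<in>L. f (last ns - 1, set (butlast ns)) = ns"
    proof
      fix ns assume ns: "ns \<in> L"
      then obtain xs n where eq: "ns = xs @ [n]"
        by (cases ns rule: rev_cases) (auto simp: L_def ks_def)
      have "sorted_list_of_set (set xs) = xs"
        using ns by (intro sorted_list_of_set.idem_if_sorted_distinct)
          (auto simp: L_def eq sorted_wrt_append strict_sorted_iff)
      thus "f (last ns - 1, set (butlast ns)) = ns"
        using ns by (simp add: f_def eq L_def)
    qed
    show "f ` chain_set q \<subseteq> L"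
    proof safe
      fix m A assume mA: "(m, A) \<in> chain_set q"
      hence "finite A" by (auto simp: chain_set_def intro: finite_subset)
      thus "f (m, A) \<in> L" using mA
        by (auto simp: chain_set_def f_def L_def ks_def sorted_wrt_append less_Suc_eq_le)
    qed
    show "(\<lambda>ns. (last ns - 1, set (butlast ns))) ` L \<subseteq> chain_set q"
    proof safe
      fix ns assume ns: "ns \<in> L"
      then obtain xs n where eq: "ns = xs @ [n]"
        by (cases ns rule: rev_cases) (auto simp: L_def ks_def)
      have "distinct xs" using ns by (auto simp: L_def eq sorted_wrt_append strict_sorted_iff)
      hence "card (set xs) = q" using ns by (simp add: distinct_card L_def ks_def eq)
      thus "(last ns - 1, set (butlast ns)) \<in> chain_set q"
        using ns by (force simp: chain_set_def eq L_def sorted_wrt_append)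
    qed
  qed
  have "H (Suc p) (Suc q) = (\<Sum>\<^sub>\<infinity>ns\<in>L. \<Prod>i<length ks. 1 / real (ns ! i) ^ (ks ! i))"
    by (simp add: H_def mzv_def L_def ks_def)
  also have "\<dots> = (\<Sum>\<^sub>\<infinity>z\<in>chain_set q. \<Prod>i<length ks. 1 / real (f z ! i) ^ (ks ! i))"
    by (rule infsum_reindex_bij_betw[OF bij, symmetric])
  also have "\<dots> = infsum (chain_term p) (chain_set q)"
  proof (rule infsum_cong)
    fix z assume "z \<in> chain_set q"
    moreover obtain m A where z: "z = (m, A)" by fastforce
    ultimately have A: "finite A" "card A = q" by (auto simp: chain_set_def intro: finite_subset)
    define xs where "xs = sorted_list_of_set A"
    have xs: "length xs = q" "set xs = A" "distinct xs" using A by (auto simp: xs_def)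
    have "(\<Prod>i<length ks. 1 / real (f z ! i) ^ (ks ! i)) =
            (\<Prod>i<q. 1 / real (xs ! i)) * (1 / real (Suc m) ^ (p + 2))"
      using xs(1) by (simp add: ks_def f_def z nth_append flip: xs_def)
    also have "(\<Prod>i<q. 1 / real (xs ! i)) = (\<Prod>i\<in>A. 1 / real i)"
      using xs by (intro prod.reindex_bij_betw bij_betw_nth) auto
    finally show "(\<Prod>i<length ks. 1 / real (f z ! i) ^ (ks ! i)) = chain_term p z"
      by (simp add: chain_term_def z)
  qed
  finally show ?thesis .
qed

text \<open>Groups the triples (m, A, p) by p and q = card A, which exposes the summands of
  \<open>H\<close>.\<close>

lemma gen_term_has_sum_chains:
  assumes "2 * norm x + norm y < 1" "x \<noteq> 0" "y \<noteq> (0 :: complex)"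
  shows "((\<lambda>((p, q), z). x ^ p * y ^ q * of_real (chain_term p z)) has_sum
           ((1 - Gamma (1 - x) * Gamma (1 - y) / Gamma (1 - x - y)) / (x * y)))
           (SIGMA (p, q):UNIV. chain_set q)"
proof -
  have "((\<lambda>((p, q), z). x ^ p * y ^ q * of_real (chain_term p z)) has_sum S) (SIGMA (p, q):UNIV. chain_set q)
     \<longleftrightarrow> (gen_term x y has_sum S) (SIGMA m:UNIV. Pow {1..m} \<times> UNIV)" for S
    by (rule has_sum_reindex_bij_witness[where
          i = "\<lambda>(m, A, p). ((p, card A), (m, A))" and j = "\<lambda>((p, q), (m, A)). (m, A, p)"])
       (auto simp: chain_set_def gen_term_def chain_term_def prod_dividef power_add)
  thus ?thesis using gen_term_has_sum[OF assms(2,3,1)] by simp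
qed

text \<open>Ensures that \<open>H\<close> is a genuine sum and not a default value: up to a nonzero
  constant its summands form one fibre of a summable family.\<close>

lemma chain_term_has_sum: "(chain_term p has_sum H (Suc p) (Suc q)) (chain_set q)"
proof -
  \<comment> \<open>Any nonzero point with 2 |x| + |y| < 1 would serve; here the left side is
    3/4.\<close>
  let ?x = "1 / 4 :: complex"
  have "(\<lambda>((p, q), z). ?x ^ p * ?x ^ q * of_real (chain_term p z)) summable_on (SIGMA (p, q):UNIV. chain_set q)"
    using gen_term_has_sum_chains[of ?x ?x] by (auto simp: summable_on_def norm_divide)
  from summable_on_SigmaD1[OF this, of "(p, q)"]
  have "(\<lambda>z. (?x ^ p * ?x ^ q) * complex_of_real (chain_term p z)) summable_on chain_set q"
    by simp
  hence "(\<lambda>z. complex_of_real (chain_term p z)) summable_on chain_set q"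
    by (subst (asm) summable_on_cmult_right') auto
  hence "chain_term p summable_on chain_set q"
    using summable_on_Re by fastforce
  thus ?thesis by (simp add: H_eq_infsum_chains)
qed

theorem H_generating_function:
  fixes x y :: complex
  assumes "2 * norm x + norm y < 1" "x \<noteq> 0" "y \<noteq> 0"
  shows "((\<lambda>(p, q). x ^ p * y ^ q * of_real (H (Suc p) (Suc q))) has_sum
           ((1 - Gamma (1 - x) * Gamma (1 - y) / Gamma (1 - x - y)) / (x * y))) UNIV"
proof (rule has_sum_SigmaD[OF gen_term_has_sum_chains[OF assms]])
  fix pq :: "nat \<times> nat"
  obtain p q where pq: "pq = (p, q)" by fastforce
  have "((\<lambda>z. x ^ p * y ^ q * complex_of_real (chain_term p z)) has_sum
     (x ^ p * y ^ q * of_real (H (Suc p) (Suc q)))) (chain_set q)"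
    by (intro has_sum_cmult_right has_sum_of_real chain_term_has_sum)
  thus "((\<lambda>z. (\<lambda>((p, q), z). x ^ p * y ^ q * of_real (chain_term p z)) (pq, z)) has_sum
     (case pq of (p, q) \<Rightarrow> x ^ p * y ^ q * of_real (H (Suc p) (Suc q)))) (case pq of (p, q) \<Rightarrow> chain_set q)"
    by (simp add: pq)
qed

section \<open>The generating function of eta\<close>

text \<open>Odd powers of Y cancel between the expansions at Y and -Y. The even lower index 2 k - 2
  in \<open>eta\<close> is what brings in both X + Y and X - Y.\<close>

lemma sum_even_binomial:
  fixes X Y :: "'a :: field_char_0"
  shows "(\<Sum>l | 2 * l \<le> p. of_nat (p choose (2 * l)) * X ^ (p - 2 * l) * Y ^ (2 * l)) =
           ((X + Y) ^ p + (X - Y) ^ p) / 2"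
proof -
  define f where "f Y i = of_nat (p choose i) * Y ^ i * X ^ (p - i)" for Y :: 'a and i
  have "(X + Y) ^ p + (X - Y) ^ p = (\<Sum>i\<le>p. f Y i + f (- Y) i)"
    using binomial_ring[of Y X p] binomial_ring[of "- Y" X p]
    by (simp add: f_def sum.distrib add.commute)
  also have "\<dots> = (\<Sum>i\<in>(\<lambda>l. 2 * l) ` {l. 2 * l \<le> p}. f Y i + f (- Y) i)"
  proof (rule sum.mono_neutral_right)
    show "\<forall>i\<in>{..p} - (\<lambda>l. 2 * l) ` {l. 2 * l \<le> p}. f Y i + f (- Y) i = 0"
    proof
      fix i assume i: "i \<in> {..p} - (\<lambda>l. 2 * l) ` {l. 2 * l \<le> p}"
      have "odd i"
      proof
        assume "even i"
        then obtain l where "i = 2 * l" by (elim evenE)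
        with i show False by auto
      qed
      thus "f Y i + f (- Y) i = 0" by (simp add: f_def)
    qed
  qed auto
  also have "\<dots> = (\<Sum>l | 2 * l \<le> p. f Y (2 * l) + f (- Y) (2 * l))"
    by (subst sum.reindex) (auto simp: inj_on_def)
  also have "\<dots> = 2 * (\<Sum>l | 2 * l \<le> p. of_nat (p choose (2 * l)) * X ^ (p - 2 * l) * Y ^ (2 * l))"
    unfolding sum_distrib_left by (intro sum.cong) (auto simp: f_def)
  finally show ?thesis by simp
qed

text \<open>Substitution n = d + l + 1, k = l + 1, r = q - 1, so that k + n - r - 3 = 2 l + (d - q);
  the natural subtraction is exact since q <= d.\<close>

lemma eta_eq_sum:
  "eta (Suc (d + l)) (Suc l) =
     (\<Sum>q\<le>d. (-2) ^ Suc q * real ((2 * l + (d - q)) choose (2 * l)) * H (Suc (2 * l + (d - q))) (Suc q))"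
  unfolding eta_def
proof (rule sum.reindex_bij_witness[where j = "\<lambda>r. nat (r + 1)" and i = "\<lambda>q. int q - 1"])
  fix r assume "r \<in> {- 1..int (Suc (d + l)) - int (Suc l) - 1}"
  hence r: "- 1 \<le> r" "r + 1 \<le> int d" by auto
  define q where "q = nat (r + 1)"
  have r_eq: "r = int q - 1" and "q \<le> d" using r by (auto simp: q_def)
  hence *: "nat (r + 2) = Suc q" "2 * Suc l - 2 = 2 * l"
    "nat (int (Suc l) + int (Suc (d + l)) - r - 3) = 2 * l + (d - q)"
    "nat (int (Suc l) + int (Suc (d + l)) - r - 2) = Suc (2 * l + (d - q))"
    by (auto simp: nat_eq_iff of_nat_diff)
  show "(- 2) ^ Suc (nat (r + 1)) * real (2 * l + (d - nat (r + 1)) choose (2 * l)) *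
          H (Suc (2 * l + (d - nat (r + 1)))) (Suc (nat (r + 1))) =
        (- 2) ^ nat (r + 2) *
          real (nat (int (Suc l) + int (Suc (d + l)) - r - 3) choose (2 * Suc l - 2)) *
          H (nat (int (Suc l) + int (Suc (d + l)) - r - 2)) (nat (r + 2))"
    unfolding * q_def[symmetric] ..
qed auto

lemma H_nonneg: "H (Suc p) (Suc q) \<ge> 0"
  unfolding H_eq_infsum_chains
  by (intro infsum_nonneg) (auto simp: chain_term_def intro!: prod_nonneg divide_nonneg_nonneg)

text \<open>From (-2)^(q+1) X^d with d = q + (p - 2 l), the power (-2 X)^q is kept here and X^(p - 2
  l) goes to the binomial sum. The spare -2 meets the 1/2 of \<open>sum_even_binomial\<close> and
  leaves the sign in front of the two values of G.\<close>

definition gen_coeff :: "complex \<Rightarrow> nat \<times> nat \<Rightarrow> complex" where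
  "gen_coeff X = (\<lambda>(p, q). - 2 * (- 2 * X) ^ q * of_real (H (Suc p) (Suc q)))"

definition eta_term :: "complex \<Rightarrow> complex \<Rightarrow> (nat \<times> nat) \<times> nat \<Rightarrow> complex" where
  "eta_term X Y = (\<lambda>((p, q), l).
     gen_coeff X (p, q) * (of_nat (p choose (2 * l)) * X ^ (p - 2 * l) * Y ^ (2 * l)))"

lemma eta_term_has_sum_inner:
  "((\<lambda>l. eta_term X Y (pq, l)) has_sum
      gen_coeff X pq * (((X + Y) ^ fst pq + (X - Y) ^ fst pq) / 2)) {l. 2 * l \<le> fst pq}"
proof (rule has_sum_finiteI)
  show "finite {l. 2 * l \<le> fst pq}" by (rule finite_subset[of _ "{..fst pq}"]) auto
  show "gen_coeff X pq * (((X + Y) ^ fst pq + (X - Y) ^ fst pq) / 2) =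
          (\<Sum>l | 2 * l \<le> fst pq. eta_term X Y (pq, l))"
    unfolding sum_even_binomial[symmetric] sum_distrib_left
    by (intro sum.cong) (auto simp: eta_term_def case_prod_unfold)
qed

lemma eta_term_summable:
  assumes "norm X < 1 / 8" "norm Y < 1 / 8"
  shows "eta_term X Y summable_on (SIGMA pq:UNIV. {l. 2 * l \<le> fst pq})"
proof (rule abs_summable_summable, rule summable_on_SigmaI)
  define X' Y' where "X' = norm X" and "Y' = norm Y"
  \<comment> \<open>The norms again form an even binomial sum, now at |X| and |Y|, so it has a
    closed form; X' - Y' may be negative.\<close>
  define g where "g pq = norm (gen_coeff X pq) * (((X' + Y') ^ fst pq + (X' - Y') ^ fst pq) / 2)" for pq
  show "((\<lambda>l. norm (eta_term X Y (pq, l))) has_sum g pq) {l. 2 * l \<le> fst pq}" for pq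
  proof (rule has_sum_finiteI)
    show "finite {l. 2 * l \<le> fst pq}" by (rule finite_subset[of _ "{..fst pq}"]) auto
    show "g pq = (\<Sum>l | 2 * l \<le> fst pq. norm (eta_term X Y (pq, l)))"
      unfolding g_def sum_even_binomial[symmetric] sum_distrib_left X'_def Y'_def
      by (intro sum.cong) (auto simp: eta_term_def case_prod_unfold norm_mult norm_power)
  qed
  \<comment> \<open>Comparison point: |X| + |Y| < 1/4 and 2 |X| < 1/4. The bound also covers points
    where X, X + Y or X - Y vanishes.\<close>
  have "(\<lambda>(p, q). (1 / 4) ^ p * (1 / 4) ^ q * complex_of_real (H (Suc p) (Suc q))) summable_on UNIV"
    using H_generating_function[of "1 / 4" "1 / 4"] by (auto simp: summable_on_def norm_divide)
  hence "(\<lambda>pq. norm (case pq of (p, q) \<Rightarrow> (1 / 4) ^ p * (1 / 4) ^ q * complex_of_real (H (Suc p) (Suc q))))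
           summable_on UNIV"
    by (rule summable_on_iff_abs_summable_on_complex[THEN iffD1])
  hence "(\<lambda>pq. 2 * norm (case pq of (p, q) \<Rightarrow> (1 / 4) ^ p * (1 / 4) ^ q * complex_of_real (H (Suc p) (Suc q))))
           summable_on UNIV"
    by (rule summable_on_cmult_right)
  hence "(\<lambda>pq. norm (g pq)) summable_on UNIV"
  proof (rule Infinite_Sum.abs_summable_on_comparison_test')
    fix pq :: "nat \<times> nat"
    obtain p q where pq: "pq = (p, q)" by fastforce
    have "\<bar>X' - Y'\<bar> ^ p \<le> (1 / 4) ^ p" "(X' + Y') ^ p \<le> (1 / 4) ^ p"
      using assms norm_ge_zero[of X] norm_ge_zero[of Y] unfolding X'_def Y'_def
      by (intro power_mono; linarith)+
    hence le: "\<bar>((X' + Y') ^ p + (X' - Y') ^ p) / 2\<bar> \<le> (1 / 4) ^ p"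
      using abs_triangle_ineq[of "(X' + Y') ^ p" "(X' - Y') ^ p"]
      by (simp add: power_abs X'_def Y'_def)
    have "norm (gen_coeff X pq) = 2 * (2 * X') ^ q * H (Suc p) (Suc q)"
      using H_nonneg[of p q] by (simp add: gen_coeff_def pq norm_mult norm_power X'_def)
    also have "\<dots> \<le> 2 * (1 / 4) ^ q * H (Suc p) (Suc q)"
      using assms H_nonneg[of p q]
      by (intro mult_right_mono mult_left_mono power_mono) (auto simp: X'_def)
    finally have "norm (g pq) \<le> 2 * (1 / 4) ^ q * H (Suc p) (Suc q) * (1 / 4) ^ p"
      unfolding g_def pq fst_conv real_norm_def abs_mult abs_norm_cancel
      using H_nonneg[of p q] le by (intro mult_mono) auto
    thus "norm (g pq) \<le> 2 * norm (case pq of (p, q) \<Rightarrow>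
             (1 / 4) ^ p * (1 / 4) ^ q * complex_of_real (H (Suc p) (Suc q)))"
      using H_nonneg[of p q] by (simp add: pq norm_mult norm_power norm_divide mult_ac)
  qed
  thus "g summable_on UNIV" by (rule abs_summable_summable)
qed auto

text \<open>
  The substitution \<open>p = 2 * l + (d - q)\<close>, where \<open>d = n - k\<close> and \<open>l = k - 1\<close>.
\<close>
lemma eta_term_has_sum_reindex:
  "(eta_term X Y has_sum S) (SIGMA pq:UNIV. {l. 2 * l \<le> fst pq}) \<longleftrightarrow>
   ((\<lambda>((d, l), q). eta_term X Y ((2 * l + (d - q), q), l)) has_sum S) (SIGMA dl:UNIV. {..fst dl})"
  by (rule has_sum_reindex_bij_witness[where
        j = "\<lambda>((p, q), l). ((p - 2 * l + q, l), q)" and i = "\<lambda>((d, l), q). ((2 * l + (d - q), q), l)"])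
     auto

lemma eta_series_has_sum:
  assumes "(eta_term X Y has_sum S) (SIGMA pq:UNIV. {l. 2 * l \<le> fst pq})"
  shows "((\<lambda>(n, k). of_real (eta n k) * X ^ (n - k) * Y ^ (2 * k - 2)) has_sum S)
           {(n, k). 0 < k \<and> k \<le> n}"
proof -
  have "((\<lambda>(d, l). of_real (eta (Suc (d + l)) (Suc l)) * X ^ d * Y ^ (2 * l)) has_sum S) UNIV"
  proof (rule has_sum_SigmaD[OF assms[unfolded eta_term_has_sum_reindex]])
    fix dl :: "nat \<times> nat"
    obtain d l where dl: "dl = (d, l)" by fastforce
    have "of_real (eta (Suc (d + l)) (Suc l)) * X ^ d * Y ^ (2 * l) =
            (\<Sum>q\<le>d. eta_term X Y ((2 * l + (d - q), q), l))"
      unfolding eta_eq_sum of_real_sum sum_distrib_right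
    proof (intro sum.cong refl)
      fix q assume "q \<in> {..d}"
      hence "X ^ d = X ^ q * X ^ (d - q)" by (simp flip: power_add)
      moreover have "(- 2 * X) ^ q = (- 2) ^ q * X ^ q" by (rule power_mult_distrib)
      ultimately show "of_real ((- 2) ^ Suc q * real ((2 * l + (d - q)) choose (2 * l)) *
               H (Suc (2 * l + (d - q))) (Suc q)) * X ^ d * Y ^ (2 * l) =
             eta_term X Y ((2 * l + (d - q), q), l)"
        unfolding eta_term_def gen_coeff_def prod.case by simp
    qed
    thus "((\<lambda>q. (\<lambda>((d, l), q). eta_term X Y ((2 * l + (d - q), q), l)) (dl, q)) has_sum
            (case dl of (d, l) \<Rightarrow> of_real (eta (Suc (d + l)) (Suc l)) * X ^ d * Y ^ (2 * l))) {..fst dl}"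
      by (intro has_sum_finiteI) (auto simp: dl)
  qed
  also have "?this \<longleftrightarrow> ?thesis"
    by (rule has_sum_reindex_bij_witness[where
          j = "\<lambda>(d, l). (Suc (d + l), Suc l)" and i = "\<lambda>(n, k). (n - k, k - 1)"]) auto
  finally show ?thesis .
qed

lemma eta_series_summable:
  fixes X Y :: complex
  assumes "norm X < 1 / 8" "norm Y < 1 / 8"
  shows "(\<lambda>(n, k). of_real (eta n k) * X ^ (n - k) * Y ^ (2 * k - 2)) summable_on
           {(n, k). 0 < k \<and> k \<le> n}"
  using eta_series_has_sum[OF has_sum_infsum[OF eta_term_summable[OF assms]]]
  by (auto simp: summable_on_def)

lemma eta_series_value:
  fixes X Y :: complex
  assumes "norm X < 1 / 8" "norm Y < 1 / 8" "X \<noteq> 0" "X + Y \<noteq> 0" "X - Y \<noteq> 0"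
  defines "G \<equiv> (\<lambda>x y. (1 - Gamma (1 - x) * Gamma (1 - y) / Gamma (1 - x - y)) / (x * y :: complex))"
  shows "((\<lambda>(n, k). of_real (eta n k) * X ^ (n - k) * Y ^ (2 * k - 2)) has_sum
           - (G (X + Y) (- 2 * X) + G (X - Y) (- 2 * X))) {(n, k). 0 < k \<and> k \<le> n}"
proof (rule eta_series_has_sum, rule has_sum_SigmaI)
  have H: "((\<lambda>(p, q). x ^ p * (- 2 * X) ^ q * of_real (H (Suc p) (Suc q))) has_sum G x (- 2 * X)) UNIV"
    if "norm x < 1 / 4" "x \<noteq> 0" for x
    unfolding G_def by (rule H_generating_function) (use that assms in \<open>auto simp: norm_mult\<close>)
  have "norm (X + Y) < 1 / 4" "norm (X - Y) < 1 / 4"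
    using norm_triangle_ineq[of X Y] norm_triangle_ineq4[of X Y] assms(1,2) by linarith+
  hence "((\<lambda>pq. - ((case pq of (p, q) \<Rightarrow> (X + Y) ^ p * (- 2 * X) ^ q * of_real (H (Suc p) (Suc q)))
     + (case pq of (p, q) \<Rightarrow> (X - Y) ^ p * (- 2 * X) ^ q * of_real (H (Suc p) (Suc q)))))
     has_sum - (G (X + Y) (- 2 * X) + G (X - Y) (- 2 * X))) UNIV"
    using assms by (intro has_sum_uminusI has_sum_add H) auto
  also have "(\<lambda>pq. - ((case pq of (p, q) \<Rightarrow> (X + Y) ^ p * (- 2 * X) ^ q * of_real (H (Suc p) (Suc q)))
     + (case pq of (p, q) \<Rightarrow> (X - Y) ^ p * (- 2 * X) ^ q * of_real (H (Suc p) (Suc q)))))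
    = (\<lambda>pq. gen_coeff X pq * (((X + Y) ^ fst pq + (X - Y) ^ fst pq) / 2))"
    by (auto simp: gen_coeff_def fun_eq_iff algebra_simps)
  finally show "((\<lambda>pq. gen_coeff X pq * (((X + Y) ^ fst pq + (X - Y) ^ fst pq) / 2)) has_sum
       - (G (X + Y) (- 2 * X) + G (X - Y) (- 2 * X))) UNIV" .
qed (use eta_term_has_sum_inner eta_term_summable[OF assms(1,2)] in auto)

section \<open>Reflection formula and the final identity\<close>

lemma Gamma_reflection_plus_minus:
  fixes z :: complex
  assumes "z \<noteq> 0"
  shows "Gamma (1 + z) * Gamma (1 - z) = of_real pi * z / sin (of_real pi * z)"
proof -
  \<comment> \<open>The entire function \<open>rGamma\<close> avoids a case split at the poles; at
    nonzero integers both sides of the goal are 0 by the conventions for \<open>Gamma\<close> and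
    division.\<close>
  have "rGamma (1 + z) * rGamma (1 - z) = sin (of_real pi * z) / (of_real pi * z)"
  proof -
    have "rGamma (1 + z) = rGamma z / z"
      using rGamma_plus1[of z] assms by (simp add: field_simps)
    thus ?thesis by (simp add: rGamma_reflection_complex mult.commute)
  qed
  thus ?thesis by (simp add: Gamma_def field_simps flip: inverse_mult_distrib)
qed

theorem proposition11:
  shows "\<exists>\<epsilon>>0.
    (\<forall>X Y :: complex. norm X < \<epsilon> \<longrightarrow> norm Y < \<epsilon> \<longrightarrow>
       (\<lambda>(n, k). of_real (eta n k) * X ^ (n - k) * Y ^ (2 * k - 2))
         summable_on {(n, k). 0 < k \<and> k \<le> n}) \<and>
    (\<forall>X Y :: complex. norm X < \<epsilon> \<longrightarrow> norm Y < \<epsilon> \<longrightarrow>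
       X \<noteq> 0 \<longrightarrow> X + Y \<noteq> 0 \<longrightarrow> Y - X \<noteq> 0 \<longrightarrow>
       W_op X Y = (sin (of_real pi * (X + Y)) / sin (of_real pi * (Y - X)) - 1)
                  * (V_op (2 * X) (- X - Y) (Y - X) / (2 * X ^ 2 * (X + Y))))"
proof (intro exI[of _ "1 / 8"] conjI allI impI)
  fix X Y :: complex
  assume small: "norm X < 1 / 8" "norm Y < 1 / 8"
    and nz: "X \<noteq> 0" "X + Y \<noteq> 0" "Y - X \<noteq> 0"
  define a where "a = X + Y"
  define b where "b = Y - X"
  define V where "V = V_op (2 * X) (- X - Y) (Y - X)"
  \<comment> \<open>This is \<open>V\<close> with Y replaced by -Y; it arises from the value of G at
    X - Y, that is, at -b.\<close>
  define V' where "V' = V_op (2 * X) (Y - X) (- X - Y)"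
  define G where "G = (\<lambda>x y. (1 - Gamma (1 - x) * Gamma (1 - y) / Gamma (1 - x - y)) / (x * y :: complex))"
  have ab: "a \<noteq> 0" "b \<noteq> 0" "a - b = 2 * X" using nz by (auto simp: a_def b_def)
  have norm_ab: "norm a < 1" "norm b < 1"
    using norm_triangle_ineq[of X Y] norm_triangle_ineq4[of Y X] small unfolding a_def b_def by linarith+
  have Gamma_nz: "Gamma (1 + z) \<noteq> 0" "Gamma (1 - z) \<noteq> 0" if "norm z < 1" for z :: complex
  proof -
    have "Re (1 + z) > 0" "Re (1 - z) > 0"
      using that abs_Re_le_cmod[of z] by auto
    thus "Gamma (1 + z) \<noteq> 0" "Gamma (1 - z) \<noteq> 0"
      by (auto simp: Gamma_eq_zero_iff elim!: nonpos_Ints_cases simp del: plus_complex.simps minus_complex.simps)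
  qed
  have V: "V = Gamma (1 + 2 * X) * Gamma (1 - a) / Gamma (1 - b)"
    and V': "V' = Gamma (1 + 2 * X) * Gamma (1 + b) / Gamma (1 + a)"
    by (simp_all add: V_def V'_def V_op_def a_def b_def algebra_simps)
  \<comment> \<open>A vanishing sine would make the right side of the reflection formula 0 through
    division by 0, but the Gamma product is nonzero.\<close>
  have sin_nz: "sin (of_real pi * b) \<noteq> 0"
    using Gamma_reflection_plus_minus[OF ab(2)] Gamma_nz[OF norm_ab(2)] by auto
  have sin_nz': "sin (of_real pi * a) \<noteq> 0"
    using Gamma_reflection_plus_minus[OF ab(1)] Gamma_nz[OF norm_ab(1)] by auto
  \<comment> \<open>Both sides equal Gamma(1 + 2 X) Gamma(1 - a) Gamma(1 + b); reflection then turns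
    the ratio of V' to V into a ratio of sines.\<close>
  have "V' * (Gamma (1 + a) * Gamma (1 - a)) = V * (Gamma (1 + b) * Gamma (1 - b))"
    unfolding V V' using Gamma_nz norm_ab by simp
  hence "V' * (of_real pi * a / sin (of_real pi * a)) = V * (of_real pi * b / sin (of_real pi * b))"
    unfolding Gamma_reflection_plus_minus[OF ab(1)] Gamma_reflection_plus_minus[OF ab(2)] .
  hence VV': "V' / b = V / a * (sin (of_real pi * a) / sin (of_real pi * b))"
    using ab(1,2) sin_nz sin_nz' by (simp add: field_simps)

  have args: "1 - (- 2 * X) = 1 + 2 * X" "1 - a - (- 2 * X) = 1 - b"
      "1 - (- b) = 1 + b" "1 + b - (- 2 * X) = 1 + a"
    by (simp_all add: a_def b_def)
  have "G a (- 2 * X) = - ((1 - V) / (2 * X * a))" "G (- b) (- 2 * X) = (1 - V') / (2 * X * b)"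
    unfolding G_def V V' args by (simp_all add: mult.commute)
  moreover have "((\<lambda>(n, k). of_real (eta n k) * X ^ (n - k) * Y ^ (2 * k - 2)) has_sum
           - (G a (- 2 * X) + G (- b) (- 2 * X))) {(n, k). 0 < k \<and> k \<le> n}"
    using eta_series_value[OF small nz(1,2)] nz(3) unfolding a_def b_def G_def by simp
  ultimately have "((\<lambda>(n, k). of_real (eta n k) * X ^ (n - k) * Y ^ (2 * k - 2)) has_sum
           (1 - V) / (2 * X * a) - (1 - V') / (2 * X * b)) {(n, k). 0 < k \<and> k \<le> n}"
    by simp
  \<comment> \<open>The factor 1 / X restores the exponent n - k - 1, which is -1 on the diagonal n
    = k.\<close>
  hence "((\<lambda>z. 1 / X * (case z of (n, k) \<Rightarrow> of_real (eta n k) * X ^ (n - k) * Y ^ (2 * k - 2))) has_sum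
           1 / X * ((1 - V) / (2 * X * a) - (1 - V') / (2 * X * b))) {(n, k). 0 < k \<and> k \<le> n}"
    by (rule has_sum_cmult_right)
  also have "?this \<longleftrightarrow> ((\<lambda>(n, k). of_real (eta n k) * X powi (int n - int k - 1) * Y ^ (2 * k - 2)) has_sum
           1 / X * ((1 - V) / (2 * X * a) - (1 - V') / (2 * X * b))) {(n, k). 0 < k \<and> k \<le> n}"
  proof (intro has_sum_cong, safe)
    fix n k :: nat
    assume "k \<le> n"
    hence "X powi (int n - int k - 1) = X ^ (n - k) / X"
      using nz by (simp add: power_int_diff power_int_of_nat flip: of_nat_diff)
    thus "1 / X * (of_real (eta n k) * X ^ (n - k) * Y ^ (2 * k - 2)) =
            of_real (eta n k) * X powi (int n - int k - 1) * Y ^ (2 * k - 2)" by simp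
  qed
  finally have "W_op X Y = 1 / (X * a * b) + 1 / X * ((1 - V) / (2 * X * a) - (1 - V') / (2 * X * b))"
    by (simp add: W_op_def a_def b_def infsumI)
  also have "\<dots> = (V' / b - V / a) / (2 * X ^ 2) + (1 / (X * a * b) + (1 / a - 1 / b) / (2 * X ^ 2))"
    by (simp add: diff_divide_distrib add_divide_distrib power2_eq_square algebra_simps)
  \<comment> \<open>Since a - b = 2 X, the polar term of \<open>W_op\<close> cancels exactly against
    the constants 1 in 1 - V and 1 - V'.\<close>
  also have "1 / a - 1 / b = - (2 * X) / (a * b)"
    using ab by (simp add: field_simps flip: ab(3))
  also have "1 / (X * a * b) + (- (2 * X) / (a * b)) / (2 * X ^ 2) = 0"
    using ab nz by (simp add: power2_eq_square)
  also have "(V' / b - V / a) / (2 * X ^ 2) + 0 =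
      (sin (of_real pi * a) / sin (of_real pi * b) - 1) * (V / (2 * X ^ 2 * a))"
    unfolding VV' by (simp add: algebra_simps diff_divide_distrib)
  finally show "W_op X Y = (sin (of_real pi * (X + Y)) / sin (of_real pi * (Y - X)) - 1)
                  * (V_op (2 * X) (- X - Y) (Y - X) / (2 * X ^ 2 * (X + Y)))"
    by (simp only: a_def b_def V_def)
qed (use eta_series_summable in auto)

end
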